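(* Let $D\subseteq\mathbb{R}$ be an open interval, let $f:D\to\mathbb{R}$ be a sufficiently differentiable function, and let $\alpha\in D$ be a simple root of $f(x)=0$. Let $G$ (a real function of one real variable) and $H$ (a real function of three real variables) be weight functions, and consider the iterative scheme $$y_n=x_n-\frac{f(x_n)}{f'(x_n)},\qquad z_n=y_n-G(t_1)\frac{f(y_n)}{f'(x_n)},\qquad x_{n+1}=z_n-H(t_1,t_2,t_3)\frac{f(z_n)}{f'(x_n)},$$ where $t_1=\frac{f(y_n)}{f(x_n)}$, $t_2=\frac{f(z_n)}{f(x_n)}$, $t_3=\frac{f(z_n)}{f(y_n)}$. If $x_0$ is chosen sufficiently close to $\alpha$, then the following hold. (i) If $$G(0)=1,\quad \frac{dG}{dt_1}(0)=2,\quad H(0,0,0)=1,\quad \frac{\partial H}{\partial t_1}(0,0,0)=2,$$ and both $G$ and $H$ have bounded higher order derivatives, then the scheme converges to $\alpha$ with convergence order at least six. (ii) If, in addition to the conditions in (i), $$\frac{\partial^2 H}{\partial t_1^2}(0,0,0)=\frac{d^2G}{dt_1^2}(0)+2,\qquad \frac{\partial H}{\partial t_3}(0,0,0)=1,$$ then the scheme has convergence order at least seven.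
   Context: Write $e_n=x_n-\alpha$. Convergence order at least $p$ means that the error satisfies $e_{n+1}=K e_n^{p}+O(e_n^{p+1})$ as $x_n\to\alpha$, where $K$ is a constant depending on $f$ and the weight functions (possibly zero). The iteration formulas are understood at steps where all denominators are nonzero. The weight functions are smooth near the origin, and "bounded higher order derivatives" refers to the derivatives of $G$ and $H$ of orders beyond those prescribed. *)

theory Defs
  imports "HOL-Analysis.Analysis" "HOL-Library.Landau_Symbols"
begin

definition C_k_on :: "nat \<Rightarrow> real set \<Rightarrow> (real \<Rightarrow> real) \<Rightarrow> bool" where
  "C_k_on k S g \<longleftrightarrow>
     (\<forall>i<k. \<forall>x\<in>S. (deriv ^^ i) g field_differentiable at x) \<and>
     continuous_on S ((deriv ^^ k) g)"

definition partial_deriv :: "'n::finite \<Rightarrow> (real^'n \<Rightarrow> real) \<Rightarrow> real^'n \<Rightarrow> real" where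
  "partial_deriv i F p = deriv (\<lambda>s. F (p + s *\<^sub>R axis i 1)) 0"

text \<open>The list of coordinates is read from right to left: the last one is differentiated first.\<close>

definition iter_partial_deriv :: "'n::finite list \<Rightarrow> (real^'n \<Rightarrow> real) \<Rightarrow> real^'n \<Rightarrow> real" where
  "iter_partial_deriv is F = foldr partial_deriv is F"

text \<open>
  Smoothness on an open set through iterated partial derivatives: all of them, of every order and
  in every order of differentiation, exist and are continuous. The function
  \<open>deriv\<close> has an unspecified value where the derivative does not exist, hence the explicit
  existence clause.
\<close>

definition smooth_partials_on :: "(real^'n::finite) set \<Rightarrow> (real^'n \<Rightarrow> real) \<Rightarrow> bool" where
  "smooth_partials_on U F \<longleftrightarrow>
     (\<forall>is. continuous_on U (iter_partial_deriv is F) \<and>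
        (\<forall>i. \<forall>p\<in>U. (\<lambda>s. iter_partial_deriv is F (p + s *\<^sub>R axis i 1)) field_differentiable at 0))"

text \<open>
  Weight functions: smooth near the origin, with every derivative of order at least two (the
  values of order zero and one at the origin being prescribed separately) bounded near the origin.
\<close>

definition weight_fun1 :: "(real \<Rightarrow> real) \<Rightarrow> bool" where
  "weight_fun1 G \<longleftrightarrow>
     (\<exists>U. open U \<and> 0 \<in> U \<and> (\<forall>k. C_k_on k U G) \<and>
        (\<forall>k\<ge>2. bounded ((deriv ^^ k) G ` U)))"

definition weight_fun3 :: "(real^3 \<Rightarrow> real) \<Rightarrow> bool" where
  "weight_fun3 H \<longleftrightarrow>
     (\<exists>U. open U \<and> 0 \<in> U \<and> smooth_partials_on U H \<and>
        (\<forall>is. length is \<ge> 2 \<longrightarrow> bounded (iter_partial_deriv is H ` U)))"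

definition y_step :: "(real \<Rightarrow> real) \<Rightarrow> real \<Rightarrow> real" where
  "y_step f x = x - f x / deriv f x"

definition z_step :: "(real \<Rightarrow> real) \<Rightarrow> (real \<Rightarrow> real) \<Rightarrow> real \<Rightarrow> real" where
  "z_step f G x =
     (let y = y_step f x; t1 = f y / f x
      in y - G t1 * (f y / deriv f x))"

definition x_step :: "(real \<Rightarrow> real) \<Rightarrow> (real \<Rightarrow> real) \<Rightarrow> (real^3 \<Rightarrow> real) \<Rightarrow> real \<Rightarrow> real" where
  "x_step f G H x =
     (let y = y_step f x; z = z_step f G x;
          t1 = f y / f x; t2 = f z / f x; t3 = f z / f y
      in z - H (vector [t1, t2, t3]) * (f z / deriv f x))"

definition denominators_nonzero :: "(real \<Rightarrow> real) \<Rightarrow> real \<Rightarrow> bool" where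
  "denominators_nonzero f x \<longleftrightarrow> deriv f x \<noteq> 0 \<and> f x \<noteq> 0 \<and> f (y_step f x) \<noteq> 0"

text \<open>
  Local convergence of the scheme, including that it never leaves the domain of \<open>f\<close>. Runs are not
  restricted to steps with nonzero denominators: near a simple root, \<open>deriv f\<close> does not vanish,
  and if \<open>f x = 0\<close> or \<open>f (y_step f x) = 0\<close> then, as \<open>a / 0 = 0\<close>, the step returns the
  root that has been reached. So runs all of whose denominators are nonzero are covered, and
  so are those that hit the root after finitely many steps.
\<close>

definition scheme_converges ::
  "real set \<Rightarrow> (real \<Rightarrow> real) \<Rightarrow> (real \<Rightarrow> real) \<Rightarrow> (real^3 \<Rightarrow> real) \<Rightarrow> real \<Rightarrow> bool" where
  "scheme_converges D f G H \<alpha> \<longleftrightarrow>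
     (\<exists>\<delta>>0. \<forall>x :: nat \<Rightarrow> real.
        \<bar>x 0 - \<alpha>\<bar> < \<delta> \<longrightarrow> (\<forall>n. x (Suc n) = x_step f G H (x n)) \<longrightarrow>
          (\<forall>n. x n \<in> D \<and> y_step f (x n) \<in> D \<and> z_step f G (x n) \<in> D) \<and> x \<longlonglongrightarrow> \<alpha>)"

text \<open>
  The error equation \<open>e' = K * e ^ p + O(e ^ (p + 1))\<close> for one step, where \<open>e = x - \<alpha>\<close> is the error
  before the step and \<open>e' = x_step f G H x - \<alpha>\<close> the error after it. The constant \<open>K\<close> may be zero;
  it may depend on \<open>f\<close>, \<open>G\<close>, \<open>H\<close> and \<open>\<alpha>\<close>, but not on \<open>x\<close>.
\<close>

definition scheme_order_at_least ::
  "nat \<Rightarrow> real set \<Rightarrow> (real \<Rightarrow> real) \<Rightarrow> (real \<Rightarrow> real) \<Rightarrow> (real^3 \<Rightarrow> real) \<Rightarrow> real \<Rightarrow> bool" where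
  "scheme_order_at_least p D f G H \<alpha> \<longleftrightarrow>
     (\<exists>K. (\<lambda>x. (x_step f G H x - \<alpha>) - K * (x - \<alpha>) ^ p)
        \<in> O[at \<alpha> within {x \<in> D. denominators_nonzero f x}](\<lambda>x. (x - \<alpha>) ^ (p + 1)))"

end

theory Submission
  imports Defs
begin

text \<open>
  Write \<open>x = \<alpha> + e\<close> and \<open>f (\<alpha> + e) = e * Q e\<close>. Each error of the step factors through the previous one:
  \<open>y - \<alpha> = e * Y\<close>, \<open>z - \<alpha> = e * Y * T\<close> and \<open>x' - \<alpha> = e * Y * T * W\<close>, where \<open>Y = 1 - Q(e) / f'(x)\<close>,
  \<open>T = 1 - G(t\<^sub>1) * Q(y - \<alpha>) / f'(x)\<close> and \<open>W = 1 - H(t\<^sub>1,t\<^sub>2,t\<^sub>3) * Q(z - \<alpha>) / f'(x)\<close>. In this form all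
  quotients \<open>t\<^sub>i\<close> are regular at \<open>e = 0\<close>, even if \<open>f''(\<alpha>) = 0\<close>. So third-order Taylor expansions with
  remainder \<open>O(e\<^sup>4)\<close> suffice: \<open>Y = O(e)\<close>, \<open>T = O(e\<^sup>2)\<close> and \<open>W = O(e\<^sup>2)\<close>, and the conditions of the second
  part make the \<open>e\<^sup>2\<close> coefficient of \<open>W\<close> vanish.
\<close>

section \<open>Cubic expansions at the origin and their arithmetic\<close>

text \<open>
  The cubic coefficient is left unspecified: only its existence matters. The filter is
  \<open>nhds 0\<close> instead of \<open>at 0\<close> so that expansions compose even when the inner function has
  zeros accumulating at the origin.
\<close>

definition jet :: "(real \<Rightarrow> real) \<Rightarrow> real \<Rightarrow> real \<Rightarrow> real \<Rightarrow> bool" where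
  "jet g a b c \<longleftrightarrow>
     (\<exists>d. (\<lambda>e. g e - (a + b * e + c * e\<^sup>2 + d * e ^ 3)) \<in> O[nhds 0](\<lambda>e. e ^ 4))"

lemma jetI:
  assumes "(\<lambda>e. g e - (a + b * e + c * e\<^sup>2 + d * e ^ 3)) \<in> O[nhds 0](\<lambda>e. e ^ 4)"
  shows "jet g a b c"
  using assms unfolding jet_def by blast

lemma jet_eq_rhs: "jet g a b c \<Longrightarrow> a = a' \<Longrightarrow> b = b' \<Longrightarrow> c = c' \<Longrightarrow> jet g a' b' c'"
  by simp

text \<open>Lets the automatic limit rules work along \<open>nhds\<close>, the filter of all
  expansions below.\<close>

lemma tendsto_ident_nhds [tendsto_intros]: "((\<lambda>x. x) \<longlongrightarrow> a) (nhds a)"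
  by (rule filterlim_ident)

lemma power_bigo_power:
  assumes "m \<le> n"
  shows "(\<lambda>e::real. e ^ n) \<in> O[nhds 0](\<lambda>e. e ^ m)"
proof (rule bigoI[of _ 1])
  have "\<forall>\<^sub>F e in nhds (0::real). \<bar>e\<bar> < 1"
    by (rule order_tendstoD) (auto intro!: tendsto_eq_intros)
  then show "\<forall>\<^sub>F e in nhds (0::real). norm (e ^ n) \<le> 1 * norm (e ^ m)"
    by eventually_elim (simp add: power_abs power_decreasing assms)
qed

lemma jet_const: "jet (\<lambda>e. k) k 0 0"
  by (rule jetI[where d = 0]) simp

lemma jet_id: "jet (\<lambda>e. e) 0 1 0"
  by (rule jetI[where d = 0]) simp

lemma jet_bigo: "g \<in> O[nhds 0](\<lambda>e. e ^ 4) \<Longrightarrow> jet g 0 0 0"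
  by (rule jetI[where d = 0]) simp

lemma jet_add:
  assumes "jet g a b c" "jet h a' b' c'"
  shows "jet (\<lambda>e. g e + h e) (a + a') (b + b') (c + c')"
proof -
  obtain d d' where d:
    "(\<lambda>e. g e - (a + b * e + c * e\<^sup>2 + d * e ^ 3)) \<in> O[nhds 0](\<lambda>e. e ^ 4)"
    "(\<lambda>e. h e - (a' + b' * e + c' * e\<^sup>2 + d' * e ^ 3)) \<in> O[nhds 0](\<lambda>e. e ^ 4)"
    using assms unfolding jet_def by blast
  show ?thesis
    by (rule jetI[where d = "d + d'"], rule landau_o.big.in_cong[THEN iffD1, OF _ sum_in_bigo(1)[OF d]])
      (simp add: algebra_simps)
qed

lemma
  assumes "jet g a b c"
  shows jet_tendsto: "(g \<longlongrightarrow> a) (nhds 0)" and jet_bigo_one: "g \<in> O[nhds 0](\<lambda>e. 1)"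
proof -
  obtain d where d: "(\<lambda>e. g e - (a + b * e + c * e\<^sup>2 + d * e ^ 3)) \<in> O[nhds 0](\<lambda>e. e ^ 4)"
    using assms unfolding jet_def by blast
  then obtain k where "\<forall>\<^sub>F e in nhds 0. norm (g e - (a + b * e + c * e\<^sup>2 + d * e ^ 3)) \<le> k * norm (e ^ 4)"
    by (rule landau_o.bigE)
  moreover have "((\<lambda>e::real. k * norm (e ^ 4)) \<longlongrightarrow> 0) (nhds 0)"
    by (auto intro!: tendsto_eq_intros)
  ultimately have "((\<lambda>e. g e - (a + b * e + c * e\<^sup>2 + d * e ^ 3)) \<longlongrightarrow> 0) (nhds 0)"
    by (rule Lim_null_comparison)
  moreover have "((\<lambda>e. a + b * e + c * e\<^sup>2 + d * e ^ 3) \<longlongrightarrow> a) (nhds 0)"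
    by (auto intro!: tendsto_eq_intros)
  ultimately have "((\<lambda>e. (g e - (a + b * e + c * e\<^sup>2 + d * e ^ 3)) + (a + b * e + c * e\<^sup>2 + d * e ^ 3)) \<longlongrightarrow> 0 + a) (nhds 0)"
    by (rule tendsto_add)
  then show lim: "(g \<longlongrightarrow> a) (nhds 0)" by simp
  have "\<forall>\<^sub>F e in nhds 0. norm (g e) < \<bar>a\<bar> + 1"
    by (rule order_tendstoD[OF tendsto_norm[OF lim]]) simp
  then show "g \<in> O[nhds 0](\<lambda>e. 1)"
    by (intro bigoI[of _ "\<bar>a\<bar> + 1"]) (auto elim!: eventually_mono)
qed

text \<open>Every neighbourhood filter includes its centre, so the remainder bound also holds at e =
  0, where its right-hand side is 0.\<close>

lemma jet_at_0:
  assumes "jet g a b c"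
  shows "g 0 = a"
proof -
  obtain d where "(\<lambda>e. g e - (a + b * e + c * e\<^sup>2 + d * e ^ 3)) \<in> O[nhds 0](\<lambda>e. e ^ 4)"
    using assms unfolding jet_def by blast
  then obtain k where "\<forall>\<^sub>F e in nhds 0. norm (g e - (a + b * e + c * e\<^sup>2 + d * e ^ 3)) \<le> k * norm (e ^ 4)"
    by (rule landau_o.bigE)
  from eventually_nhds_x_imp_x[OF this] show ?thesis by simp
qed

text \<open>Absorbs the terms of degree 4 to 6 in the product of two cubic polynomials.\<close>

lemma power4_times_quadratic_bigo: "(\<lambda>e::real. e ^ 4 * (p + q * e + r * e\<^sup>2)) \<in> O[nhds 0](\<lambda>e. e ^ 4)"
proof -
  have "jet (\<lambda>e. p + q * e + r * e\<^sup>2) p q r"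
    by (rule jetI[where d = 0]) simp
  from landau_o.big.mult[OF landau_o.big_refl[of "\<lambda>e. e ^ 4"] jet_bigo_one[OF this]]
  show ?thesis by simp
qed

text \<open>With p and q the cubic polynomials of g and h, g h - p q = (g - p) h + p (h - q); both
  summands are a remainder times a bounded function. The truncation of p q to degree 3 leaves e^4
  times a quadratic.\<close>

lemma jet_mult:
  assumes "jet g a b c" "jet h a' b' c'"
  shows "jet (\<lambda>e. g e * h e) (a * a') (a * b' + b * a') (a * c' + b * b' + c * a')"
proof -
  obtain d d' where d:
    "(\<lambda>e. g e - (a + b * e + c * e\<^sup>2 + d * e ^ 3)) \<in> O[nhds 0](\<lambda>e. e ^ 4)"
    "(\<lambda>e. h e - (a' + b' * e + c' * e\<^sup>2 + d' * e ^ 3)) \<in> O[nhds 0](\<lambda>e. e ^ 4)"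
    using assms unfolding jet_def by blast
  have "jet (\<lambda>e. a + b * e + c * e\<^sup>2 + d * e ^ 3) a b c"
    by (rule jetI[where d = d]) simp
  note p = jet_bigo_one[OF this]
  have 1: "(\<lambda>e. (g e - (a + b * e + c * e\<^sup>2 + d * e ^ 3)) * h e) \<in> O[nhds 0](\<lambda>e. e ^ 4)"
    using landau_o.big.mult[OF d(1) jet_bigo_one[OF assms(2)]] by simp
  have 2: "(\<lambda>e. (a + b * e + c * e\<^sup>2 + d * e ^ 3) * (h e - (a' + b' * e + c' * e\<^sup>2 + d' * e ^ 3)))
      \<in> O[nhds 0](\<lambda>e. e ^ 4)"
    using landau_o.big.mult[OF p d(2)] by simp
  have 3: "(\<lambda>e::real. e ^ 4 * ((b * d' + c * c' + d * b') + (c * d' + d * c') * e + (d * d') * e\<^sup>2))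
      \<in> O[nhds 0](\<lambda>e. e ^ 4)"
    by (rule power4_times_quadratic_bigo)
  show ?thesis
    by (rule jetI[where d = "a * d' + b * c' + c * b' + d * a'"],
        rule landau_o.big.in_cong[THEN iffD1, OF _ sum_in_bigo(1)[OF sum_in_bigo(1)[OF 1 2] 3]])
      (simp add: algebra_simps power2_eq_square power3_eq_cube power4_eq_xxxx)
qed

lemma jet_cmult: "jet g a b c \<Longrightarrow> jet (\<lambda>e. k * g e) (k * a) (k * b) (k * c)"
  using jet_mult[OF jet_const] by (rule jet_eq_rhs) auto

lemma jet_diff:
  assumes "jet g a b c" "jet h a' b' c'"
  shows "jet (\<lambda>e. g e - h e) (a - a') (b - b') (c - c')"
  using jet_add[OF assms(1) jet_cmult[OF assms(2), of "-1"]] by simp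

text \<open>Without a constant term, e factors out of the polynomial part, and the cofactor is
  bounded.\<close>

lemma bigo_of_jet:
  assumes "jet g 0 b c"
  shows "g \<in> O[nhds 0](\<lambda>e. e)"
proof -
  obtain d where d: "(\<lambda>e. g e - (0 + b * e + c * e\<^sup>2 + d * e ^ 3)) \<in> O[nhds 0](\<lambda>e. e ^ 4)"
    using assms unfolding jet_def by blast
  have "jet (\<lambda>e. b + c * e + d * e\<^sup>2) b c d"
    by (rule jetI[where d = 0]) simp
  from landau_o.big.mult[OF landau_o.big_refl[of "\<lambda>e. e"] jet_bigo_one[OF this]]
  have "(\<lambda>e. e * (b + c * e + d * e\<^sup>2)) \<in> O[nhds 0](\<lambda>e. e)" by simp
  moreover have "(\<lambda>e. g e - (0 + b * e + c * e\<^sup>2 + d * e ^ 3)) \<in> O[nhds 0](\<lambda>e. e)"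
    using landau_o.big_trans[OF d power_bigo_power[of 1 4]] by simp
  ultimately have "(\<lambda>e. g e - (0 + b * e + c * e\<^sup>2 + d * e ^ 3) + e * (b + c * e + d * e\<^sup>2)) \<in> O[nhds 0](\<lambda>e. e)"
    by (rule sum_in_bigo(1)[rotated])
  then show ?thesis
    by (rule landau_o.big.in_cong[THEN iffD1, rotated])
      (simp add: algebra_simps power2_eq_square power3_eq_cube)
qed

lemma bigo2_of_jet:
  assumes "jet g 0 0 c"
  shows "g \<in> O[nhds 0](\<lambda>e. e\<^sup>2)"
proof -
  obtain d where d: "(\<lambda>e. g e - (0 + 0 * e + c * e\<^sup>2 + d * e ^ 3)) \<in> O[nhds 0](\<lambda>e. e ^ 4)"
    using assms unfolding jet_def by blast
  have "jet (\<lambda>e. c + d * e) c d 0"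
    by (rule jetI[where d = 0]) simp
  from landau_o.big.mult[OF landau_o.big_refl[of "\<lambda>e. e\<^sup>2"] jet_bigo_one[OF this]]
  have "(\<lambda>e. e\<^sup>2 * (c + d * e)) \<in> O[nhds 0](\<lambda>e. e\<^sup>2)" by simp
  moreover have "(\<lambda>e. g e - (0 + 0 * e + c * e\<^sup>2 + d * e ^ 3)) \<in> O[nhds 0](\<lambda>e. e\<^sup>2)"
    using landau_o.big_trans[OF d power_bigo_power[of 2 4]] by simp
  ultimately have "(\<lambda>e. g e - (0 + 0 * e + c * e\<^sup>2 + d * e ^ 3) + e\<^sup>2 * (c + d * e)) \<in> O[nhds 0](\<lambda>e. e\<^sup>2)"
    by (rule sum_in_bigo(1)[rotated])
  then show ?thesis
    by (rule landau_o.big.in_cong[THEN iffD1, rotated])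
      (simp add: algebra_simps power2_eq_square power3_eq_cube)
qed

text \<open>Since s = O(e), the remainder of \<open>\<Phi>\<close> at s is O(s^4) = O(e^4); what is
  left is a cubic polynomial in s, expanded by sums and products.\<close>

lemma jet_compose:
  assumes "jet \<Phi> A B C" "jet s 0 b c"
  shows "jet (\<lambda>e. \<Phi> (s e)) A (B * b) (B * c + C * b\<^sup>2)"
proof -
  obtain D where D: "(\<lambda>e. \<Phi> e - (A + B * e + C * e\<^sup>2 + D * e ^ 3)) \<in> O[nhds 0](\<lambda>e. e ^ 4)"
    using assms(1) unfolding jet_def by blast
  have "(\<lambda>e. \<Phi> (s e) - (A + B * s e + C * (s e)\<^sup>2 + D * (s e) ^ 3)) \<in> O[nhds 0](\<lambda>e. (s e) ^ 4)"
    using landau_o.big.compose[OF D jet_tendsto[OF assms(2)]] .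
  also have "(\<lambda>e. (s e) ^ 4) \<in> O[nhds 0](\<lambda>e. e ^ 4)"
    by (rule landau_o.big_power[OF bigo_of_jet[OF assms(2)]])
  finally have rest: "jet (\<lambda>e. \<Phi> (s e) - (A + B * s e + C * (s e * s e) + D * (s e * (s e * s e)))) 0 0 0"
    by (intro jet_bigo) (simp add: power2_eq_square power3_eq_cube algebra_simps)
  note s2 = jet_mult[OF assms(2) assms(2)]
  note main = jet_add[OF jet_add[OF jet_add[OF jet_const[of A] jet_cmult[OF assms(2), of B]] jet_cmult[OF s2, of C]]
      jet_cmult[OF jet_mult[OF assms(2) s2], of D]]
  have "jet (\<lambda>e. \<Phi> (s e) - (A + B * s e + C * (s e * s e) + D * (s e * (s e * s e)))
     + (A + B * s e + C * (s e * s e) + D * (s e * (s e * s e)))) A (B * b) (B * c + C * b\<^sup>2)"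
    by (rule jet_eq_rhs[OF jet_add[OF rest main]]) (simp_all add: power2_eq_square)
  then show ?thesis by simp
qed

text \<open>Composes the expansion of 1 / (a + s) with s = h - a. Its remainder is exact by the
  geometric sum: s^4 / (a^4 (a + s)), with a factor 1 / (a^4 (a + s)) that is bounded near s =
  0.\<close>

lemma jet_inverse:
  assumes "jet h a b c" "a \<noteq> 0"
  shows "jet (\<lambda>e. inverse (h e)) (1 / a) (- b / a\<^sup>2) (b\<^sup>2 / a ^ 3 - c / a\<^sup>2)"
proof -
  have lim: "((\<lambda>s. inverse (a ^ 4 * (a + s))) \<longlongrightarrow> inverse (a ^ 4 * (a + 0))) (nhds 0)"
    using assms(2) by (intro tendsto_intros) auto
  have "\<forall>\<^sub>F s in nhds 0. norm (inverse (a ^ 4 * (a + s))) < norm (inverse (a ^ 4 * (a + 0))) + 1"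
    by (rule order_tendstoD[OF tendsto_norm[OF lim]]) simp
  then have bd: "(\<lambda>s. inverse (a ^ 4 * (a + s))) \<in> O[nhds 0](\<lambda>e. 1)"
    by (intro bigoI[of _ "norm (inverse (a ^ 4 * (a + 0))) + 1"]) (auto elim!: eventually_mono)
  have "((\<lambda>s. a + s) \<longlongrightarrow> a + 0) (nhds 0)" by (intro tendsto_intros)
  then have ne: "\<forall>\<^sub>F s in nhds 0. a + s \<noteq> 0"
    using tendsto_imp_eventually_ne assms(2) by fastforce
  have J: "jet (\<lambda>s. inverse (a + s)) (1 / a) (- 1 / a\<^sup>2) (1 / a ^ 3)"
  proof (rule jetI[where d = "- 1 / a ^ 4"], rule landau_o.big.in_cong[THEN iffD1])
    show "(\<lambda>s. s ^ 4 * inverse (a ^ 4 * (a + s))) \<in> O[nhds 0](\<lambda>s. s ^ 4)"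
      using landau_o.big.mult[OF landau_o.big_refl[of "\<lambda>s. s ^ 4"] bd] by simp
    show "\<forall>\<^sub>F s in nhds 0. s ^ 4 * inverse (a ^ 4 * (a + s)) =
      inverse (a + s) - (1 / a + - 1 / a\<^sup>2 * s + 1 / a ^ 3 * s\<^sup>2 + - 1 / a ^ 4 * s ^ 3)"
      using ne
    proof eventually_elim
      case (elim s)
      then show ?case using assms(2)
        by (simp add: divide_simps) (simp add: eval_nat_numeral algebra_simps)
    qed
  qed
  have "jet (\<lambda>e. h e - a) 0 b c"
    using jet_diff[OF assms(1) jet_const[of a]] by simp
  from jet_compose[OF J this]
  have "jet (\<lambda>e. inverse (h e)) (1 / a) (- 1 / a\<^sup>2 * b) (- 1 / a\<^sup>2 * c + 1 / a ^ 3 * b\<^sup>2)"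
    by simp
  then show ?thesis by (rule jet_eq_rhs) simp_all
qed

text \<open>The coefficients have the shape of power series division: each one is found from the
  previous ones and then divided by a'.\<close>

lemma jet_divide:
  assumes "jet g a b c" "jet h a' b' c'" "a' \<noteq> 0"
  shows "jet (\<lambda>e. g e / h e) (a / a') ((b - a / a' * b') / a')
     ((c - a / a' * c' - (b - a / a' * b') / a' * b') / a')"
  unfolding divide_inverse[of "g _"]
  by (rule jet_eq_rhs[OF jet_mult[OF assms(1) jet_inverse[OF assms(2,3)]]])
    (use assms(3) in \<open>simp_all add: field_simps power2_eq_square power3_eq_cube\<close>)

section \<open>Taylor expansion on the line and along coordinate axes\<close>

text \<open>Lagrange form of the remainder, with the factor 1 / n! bounded crudely by 1.\<close>

lemma taylor_bound:
  fixes diff :: "nat \<Rightarrow> real \<Rightarrow> real"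
  assumes "\<And>m t. m < n \<Longrightarrow> \<bar>t\<bar> \<le> \<bar>s\<bar> \<Longrightarrow> (diff m has_real_derivative diff (Suc m) t) (at t)"
    and "\<And>t. \<bar>t\<bar> \<le> \<bar>s\<bar> \<Longrightarrow> \<bar>diff n t\<bar> \<le> B"
  shows "\<bar>diff 0 s - (\<Sum>m<n. diff m 0 / fact m * s ^ m)\<bar> \<le> B * \<bar>s\<bar> ^ n"
proof -
  obtain t where t: "\<bar>t\<bar> \<le> \<bar>s\<bar>"
    "diff 0 s = (\<Sum>m<n. diff m 0 / fact m * s ^ m) + diff n t / fact n * s ^ n"
    using Maclaurin_bi_le[of diff "diff 0" n s] assms(1) by blast
  have "\<bar>diff n t / fact n\<bar> \<le> \<bar>diff n t\<bar> / 1"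
    unfolding abs_divide by (intro divide_left_mono) (auto intro: order_trans[OF fact_ge_1])
  then have "\<bar>diff n t / fact n\<bar> \<le> B" using assms(2)[OF t(1)] by simp
  then have "\<bar>diff n t / fact n * s ^ n\<bar> \<le> B * \<bar>s\<bar> ^ n"
    unfolding abs_mult power_abs by (intro mult_right_mono) auto
  then show ?thesis using t(2) by simp
qed

lemma jet_taylor:
  fixes diff :: "nat \<Rightarrow> real \<Rightarrow> real"
  assumes "r > 0"
    and "\<And>m t. m < 4 \<Longrightarrow> \<bar>t\<bar> < r \<Longrightarrow> (diff m has_real_derivative diff (Suc m) t) (at t)"
    and "\<And>t. \<bar>t\<bar> < r \<Longrightarrow> \<bar>diff 4 t\<bar> \<le> B"
  shows "jet (diff 0) (diff 0 0) (diff 1 0) (diff 2 0 / 2)"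
proof (rule jetI[where d = "diff 3 0 / 6"], rule bigoI[of _ B])
  have "\<forall>\<^sub>F e in nhds (0::real). \<bar>e\<bar> < r"
    by (rule order_tendstoD) (auto intro!: tendsto_eq_intros assms(1))
  then show "\<forall>\<^sub>F e in nhds 0. norm (diff 0 e - (diff 0 0 + diff 1 0 * e + diff 2 0 / 2 * e\<^sup>2
     + diff 3 0 / 6 * e ^ 3)) \<le> B * norm (e ^ 4)"
  proof eventually_elim
    case (elim e)
    have "\<bar>diff 0 e - (\<Sum>m<4. diff m 0 / fact m * e ^ m)\<bar> \<le> B * \<bar>e\<bar> ^ 4"
      using elim by (intro taylor_bound assms) auto
    then show ?case by (simp add: eval_nat_numeral abs_mult)
  qed
qed

lemma iter_partial_deriv_Nil: "iter_partial_deriv [] F = F"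
  and iter_partial_deriv_Cons:
    "iter_partial_deriv (i # is) F = partial_deriv i (iter_partial_deriv is F)"
  by (simp_all add: iter_partial_deriv_def)

text \<open>Smoothness speaks about the parameter value 0 on the line through each point; taking p +
  t e_i as the base point and shifting the parameter gives the derivative at every t.\<close>

lemma has_derivative_along_axis:
  assumes "smooth_partials_on U F" "p + t *\<^sub>R axis i 1 \<in> U"
  shows "((\<lambda>s. iter_partial_deriv is F (p + s *\<^sub>R axis i 1)) has_real_derivative
     iter_partial_deriv (i # is) F (p + t *\<^sub>R axis i 1)) (at t)"
proof -
  have "(\<lambda>s. iter_partial_deriv is F (p + t *\<^sub>R axis i 1 + s *\<^sub>R axis i 1)) field_differentiable at 0"
    using assms unfolding smooth_partials_on_def by blast
  then have "((\<lambda>s. iter_partial_deriv is F (p + t *\<^sub>R axis i 1 + s *\<^sub>R axis i 1)) has_real_derivative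
     iter_partial_deriv (i # is) F (p + t *\<^sub>R axis i 1)) (at 0)"
    unfolding iter_partial_deriv_Cons partial_deriv_def
    by (rule field_differentiable_derivI)
  then have "((\<lambda>s. iter_partial_deriv is F (p + (s + t) *\<^sub>R axis i 1)) has_real_derivative
     iter_partial_deriv (i # is) F (p + t *\<^sub>R axis i 1)) (at 0)"
    by (simp add: scaleR_add_left add_ac)
  then show ?thesis
    using DERIV_shift[of "\<lambda>s. iter_partial_deriv is F (p + s *\<^sub>R axis i 1)" _ 0 t] by simp
qed

lemma taylor_bound_along_axis:
  assumes "smooth_partials_on U F"
    and "\<And>t. \<bar>t\<bar> \<le> \<bar>s\<bar> \<Longrightarrow> p + t *\<^sub>R axis i 1 \<in> U"
    and "\<And>q. q \<in> U \<Longrightarrow> \<bar>iter_partial_deriv (replicate n i @ is) F q\<bar> \<le> B"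
  shows "\<bar>iter_partial_deriv is F (p + s *\<^sub>R axis i 1) -
     (\<Sum>m<n. iter_partial_deriv (replicate m i @ is) F p / fact m * s ^ m)\<bar> \<le> B * \<bar>s\<bar> ^ n"
  using taylor_bound[of n s "\<lambda>m t. iter_partial_deriv (replicate m i @ is) F (p + t *\<^sub>R axis i 1)" B]
    has_derivative_along_axis[OF assms(1,2)] assms(2,3) by simp

lemma jet_along_axis:
  assumes "smooth_partials_on U F" "r > 0" "ball 0 r \<subseteq> U"
    and "\<And>q. q \<in> U \<Longrightarrow> \<bar>iter_partial_deriv (replicate 4 i @ is) F q\<bar> \<le> B"
  shows "jet (\<lambda>s. iter_partial_deriv is F (s *\<^sub>R axis i 1)) (iter_partial_deriv is F 0)
     (iter_partial_deriv (i # is) F 0) (iter_partial_deriv (i # i # is) F 0 / 2)"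
proof -
  have U: "0 + t *\<^sub>R axis i 1 \<in> U" if "\<bar>t\<bar> < r" for t
    using that assms(3) by (auto simp: subset_iff)
  have "jet (\<lambda>s. iter_partial_deriv (replicate 0 i @ is) F (0 + s *\<^sub>R axis i 1))
     (iter_partial_deriv (replicate 0 i @ is) F (0 + 0 *\<^sub>R axis i 1))
     (iter_partial_deriv (replicate 1 i @ is) F (0 + 0 *\<^sub>R axis i 1))
     (iter_partial_deriv (replicate 2 i @ is) F (0 + 0 *\<^sub>R axis i 1) / 2)"
    by (rule jet_taylor[OF assms(2), where B = B and
          diff = "\<lambda>m s. iter_partial_deriv (replicate m i @ is) F (0 + s *\<^sub>R axis i 1)"])
      (use has_derivative_along_axis[OF assms(1) U] assms(4) U in \<open>auto simp del: add_0_left\<close>)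
  then show ?thesis by (simp add: numeral_2_eq_2)
qed

section \<open>Expansion of the three-variable weight function\<close>

text \<open>As t2 and t3 are O(e^2), terms quadratic in them are O(e^4). Hence H may be replaced by
  its value on the first axis plus t2 and t3 times the partial derivatives there, and these are
  functions of t1 alone.\<close>

lemma jet_weight_fun3:
  assumes "weight_fun3 H" "jet t1 0 b c" "jet t2 0 0 r2" "jet t3 0 0 r3"
  shows "jet (\<lambda>e. H (vector [t1 e, t2 e, t3 e])) (H 0) (partial_deriv 1 H 0 * b)
     (partial_deriv 1 H 0 * c + partial_deriv 2 H 0 * r2 + partial_deriv 3 H 0 * r3
        + partial_deriv 1 (partial_deriv 1 H) 0 / 2 * b\<^sup>2)"
proof -
  obtain U where U: "open U" "0 \<in> U" and smooth: "smooth_partials_on U H"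
    and bdd: "\<And>is. length is \<ge> 2 \<Longrightarrow> bounded (iter_partial_deriv is H ` U)"
    using assms(1) unfolding weight_fun3_def by blast
  define B where "B is = (SOME B. \<forall>q\<in>U. \<bar>iter_partial_deriv is H q\<bar> \<le> B)" for "is"
  have B: "\<bar>iter_partial_deriv is H q\<bar> \<le> B is" if "length is \<ge> 2" "q \<in> U" for "is" q
  proof -
    have "\<exists>B. \<forall>q\<in>U. \<bar>iter_partial_deriv is H q\<bar> \<le> B"
      using bdd[OF that(1)] unfolding bounded_iff by auto
    from someI_ex[OF this] that(2) show ?thesis unfolding B_def by blast
  qed
  obtain r where r: "r > 0" "ball 0 r \<subseteq> U"
    using U by (meson openE)
  define v :: "real \<Rightarrow> real \<Rightarrow> real \<Rightarrow> real^3" where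
    "v x y z = x *\<^sub>R axis 1 1 + y *\<^sub>R axis 2 1 + z *\<^sub>R axis 3 1" for x y z
  have v: "vector [x, y, z] = v x y z" for x y z
    by (simp add: v_def vec_eq_iff forall_3 axis_def)
  \<comment> \<open>A third of the radius for each coordinate keeps the point in the ball by the
    triangle inequality.\<close>
  have vU: "v x y z \<in> U" if "\<bar>x\<bar> < r / 3" "\<bar>y\<bar> < r / 3" "\<bar>z\<bar> < r / 3" for x y z
  proof -
    have "norm (v x y z) \<le> \<bar>x\<bar> + \<bar>y\<bar> + \<bar>z\<bar>"
      unfolding v_def by (rule order_trans[OF norm_triangle_ineq] add_mono)+ auto
    then have "v x y z \<in> ball 0 r" using that by simp
    then show ?thesis using r(2) by blast
  qed
  define J where "J is s = iter_partial_deriv is H (s *\<^sub>R axis 1 1)" for "is" s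
  have J: "jet (\<lambda>e. J is (t1 e)) (iter_partial_deriv is H 0) (iter_partial_deriv (1 # is) H 0 * b)
     (iter_partial_deriv (1 # is) H 0 * c + iter_partial_deriv (1 # 1 # is) H 0 / 2 * b\<^sup>2)" for "is"
    unfolding J_def by (rule jet_compose[OF jet_along_axis[OF smooth r B] assms(2)]) auto
  define R where "R e = H (v (t1 e) (t2 e) (t3 e))
     - (J [] (t1 e) + t3 e * J [3] (t1 e) + t2 e * J [2] (t1 e))" for e
  have small: "\<forall>\<^sub>F e in nhds 0. \<bar>t e\<bar> < r / 3" if "jet t 0 b' c'" for t b' c'
    by (rule order_tendstoD[OF tendsto_rabs[OF jet_tendsto[OF that]]]) (use r(1) in simp)
  \<comment> \<open>One coordinate is changed at a time: \<open>B [2,2]\<close> bounds the error of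
    moving from (t1, 0, t3) along axis 2, \<open>B [3,3]\<close> that of moving from (t1, 0, 0)
    along axis 3, and \<open>B [3,2]\<close> that of evaluating the second partial derivative at
    (t1, 0, 0) instead of (t1, 0, t3).\<close>
  have "\<forall>\<^sub>F e in nhds 0. norm (R e) \<le> norm (B [2,2] * (t2 e * t2 e) + B [3,3] * (t3 e * t3 e) + B [3,2] * \<bar>t2 e * t3 e\<bar>)"
    using small[OF assms(2)] small[OF assms(3)] small[OF assms(4)]
  proof eventually_elim
    case (elim e)
    have 2: "v x (t2 e) z = v x 0 z + t2 e *\<^sub>R axis 2 1" for x z
      by (simp add: v_def)
    have 3: "v x 0 (t3 e) = x *\<^sub>R axis 1 1 + t3 e *\<^sub>R axis 3 1" for x
      by (simp add: v_def)
    have in2: "v (t1 e) 0 (t3 e) + t *\<^sub>R axis 2 1 \<in> U" if "\<bar>t\<bar> \<le> \<bar>t2 e\<bar>" for t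
      using vU[of "t1 e" t "t3 e"] elim that by (simp add: v_def add_ac)
    have in3: "t1 e *\<^sub>R axis 1 1 + t *\<^sub>R axis 3 1 \<in> U" if "\<bar>t\<bar> \<le> \<bar>t3 e\<bar>" for t
      using vU[of "t1 e" 0 t] elim that r(1) by (simp add: v_def add_ac)
    have "\<bar>H (v (t1 e) (t2 e) (t3 e)) - (H (v (t1 e) 0 (t3 e)) + t2 e * iter_partial_deriv [2] H (v (t1 e) 0 (t3 e)))\<bar>
        \<le> B [2,2] * (t2 e * t2 e)"
      using taylor_bound_along_axis[OF smooth in2 B, of "t2 e" 2 "[]"] 2
      by (simp add: numeral_2_eq_2 iter_partial_deriv_Nil mult.commute)
    moreover have "\<bar>H (v (t1 e) 0 (t3 e)) - (J [] (t1 e) + t3 e * J [3] (t1 e))\<bar> \<le> B [3,3] * (t3 e * t3 e)"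
      using taylor_bound_along_axis[OF smooth in3 B, of "t3 e" 2 "[]"] 3
      by (simp add: numeral_2_eq_2 iter_partial_deriv_Nil J_def mult.commute)
    moreover have "\<bar>iter_partial_deriv [2] H (v (t1 e) 0 (t3 e)) - J [2] (t1 e)\<bar> \<le> B [3,2] * \<bar>t3 e\<bar>"
      using taylor_bound_along_axis[OF smooth in3 B, of "t3 e" 1 "[2]"] 3
      by (simp add: J_def)
    then have "\<bar>t2 e\<bar> * \<bar>iter_partial_deriv [2] H (v (t1 e) 0 (t3 e)) - J [2] (t1 e)\<bar> \<le> \<bar>t2 e\<bar> * (B [3,2] * \<bar>t3 e\<bar>)"
      by (rule mult_left_mono) simp
    then have "\<bar>t2 e * iter_partial_deriv [2] H (v (t1 e) 0 (t3 e)) - t2 e * J [2] (t1 e)\<bar> \<le> B [3,2] * \<bar>t2 e * t3 e\<bar>"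
      unfolding right_diff_distrib[symmetric] abs_mult by (simp add: mult_ac)
    ultimately show ?case
      unfolding R_def real_norm_def by linarith
  qed
  moreover have "(\<lambda>e. B [2,2] * (t2 e * t2 e) + B [3,3] * (t3 e * t3 e) + B [3,2] * \<bar>t2 e * t3 e\<bar>) \<in> O[nhds 0](\<lambda>e. e ^ 4)"
  proof -
    have "(\<lambda>e. s e * t e) \<in> O[nhds 0](\<lambda>e. e ^ 4)" if "s \<in> O[nhds 0](\<lambda>e. e\<^sup>2)" "t \<in> O[nhds 0](\<lambda>e. e\<^sup>2)" for s t :: "real \<Rightarrow> real"
      using landau_o.big.mult[OF that] by (simp flip: power_add)
    then show ?thesis
      using bigo2_of_jet[OF assms(3)] bigo2_of_jet[OF assms(4)]
      by (intro sum_in_bigo landau_o.big.cmult_in_iff'[THEN iffD2] impI) auto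
  qed
  ultimately have R: "jet R 0 0 0"
    by (intro jet_bigo) (rule landau_o.big_trans[OF landau_o.big_mono])
  have "jet (\<lambda>e. R e + (J [] (t1 e) + t3 e * J [3] (t1 e) + t2 e * J [2] (t1 e)))
     (H 0) (partial_deriv 1 H 0 * b)
     (partial_deriv 1 H 0 * c + partial_deriv 2 H 0 * r2 + partial_deriv 3 H 0 * r3
        + partial_deriv 1 (partial_deriv 1 H) 0 / 2 * b\<^sup>2)"
    by (rule jet_eq_rhs[OF jet_add[OF R jet_add[OF jet_add[OF J[of "[]"]
          jet_mult[OF assms(4) J]] jet_mult[OF assms(3) J]]]])
      (simp_all add: iter_partial_deriv_Nil iter_partial_deriv_Cons)
  then show ?thesis by (simp add: R_def v)
qed

section \<open>Leading terms of products\<close>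

text \<open>Combines the factors of the error beyond the degree that a jet records, through g h - K
  L e^(j+k) = g (h - L e^k) + (g - K e^j) L e^k.\<close>

lemma leading_mult:
  fixes g h :: "real \<Rightarrow> real"
  assumes "(\<lambda>e. g e - K * e ^ j) \<in> O[nhds 0](\<lambda>e. e ^ (j + 1))"
    and "(\<lambda>e. h e - L * e ^ k) \<in> O[nhds 0](\<lambda>e. e ^ (k + 1))"
  shows "(\<lambda>e. g e * h e - (K * L) * e ^ (j + k)) \<in> O[nhds 0](\<lambda>e. e ^ (j + k + 1))"
proof -
  have pw: "(\<lambda>e::real. c * e ^ n) \<in> O[nhds 0](\<lambda>e. e ^ n)" for c n
    by (rule bigoI[of _ "\<bar>c\<bar>"]) (simp add: abs_mult)
  have "(\<lambda>e. (g e - K * e ^ j) + K * e ^ j) \<in> O[nhds 0](\<lambda>e. e ^ j)"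
    by (rule sum_in_bigo(1)[OF landau_o.big_trans[OF assms(1) power_bigo_power] pw]) simp
  then have g: "g \<in> O[nhds 0](\<lambda>e. e ^ j)" by simp
  have 1: "(\<lambda>e. g e * (h e - L * e ^ k)) \<in> O[nhds 0](\<lambda>e. e ^ (j + k + 1))"
    using landau_o.big.mult[OF g assms(2)] by (simp add: power_add mult_ac)
  have 2: "(\<lambda>e. (g e - K * e ^ j) * (L * e ^ k)) \<in> O[nhds 0](\<lambda>e. e ^ (j + k + 1))"
    using landau_o.big.mult[OF assms(1) pw[of L k]] by (simp add: power_add mult_ac)
  show ?thesis
    by (rule landau_o.big.in_cong[THEN iffD1, OF _ sum_in_bigo(1)[OF 1 2]])
      (simp add: algebra_simps power_add)
qed

lemma leading_of_jet:
  assumes "jet g a b c"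
  shows "a = 0 \<Longrightarrow> (\<lambda>e. g e - b * e ^ 1) \<in> O[nhds 0](\<lambda>e. e ^ (1 + 1))"
    and "a = 0 \<Longrightarrow> b = 0 \<Longrightarrow> (\<lambda>e. g e - c * e ^ 2) \<in> O[nhds 0](\<lambda>e. e ^ (2 + 1))"
    and "a = 0 \<Longrightarrow> b = 0 \<Longrightarrow> c = 0 \<Longrightarrow> \<exists>d. (\<lambda>e. g e - d * e ^ 3) \<in> O[nhds 0](\<lambda>e. e ^ (3 + 1))"
proof -
  obtain d where d: "(\<lambda>e. g e - (a + b * e + c * e\<^sup>2 + d * e ^ 3)) \<in> O[nhds 0](\<lambda>e. e ^ 4)"
    using assms unfolding jet_def by blast
  have pw: "(\<lambda>e::real. c * e ^ n) \<in> O[nhds 0](\<lambda>e. e ^ m)" if "m \<le> n" for c n m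
    by (rule landau_o.big_trans[OF bigoI[of _ "\<bar>c\<bar>"] power_bigo_power[OF that]]) (simp add: abs_mult)
  have d': "(\<lambda>e. g e - (a + b * e + c * e\<^sup>2 + d * e ^ 3)) \<in> O[nhds 0](\<lambda>e. e ^ m)" if "m \<le> 4" for m
    by (rule landau_o.big_trans[OF d power_bigo_power[OF that]])
  show "(\<lambda>e. g e - b * e ^ 1) \<in> O[nhds 0](\<lambda>e. e ^ (1 + 1))" if "a = 0"
    by (rule landau_o.big.in_cong[THEN iffD1, OF _
          sum_in_bigo(1)[OF sum_in_bigo(1)[OF d' pw[of _ 2 c]] pw[of _ 3 d]]]) (auto simp: that)
  show "(\<lambda>e. g e - c * e ^ 2) \<in> O[nhds 0](\<lambda>e. e ^ (2 + 1))" if "a = 0" "b = 0"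
    by (rule landau_o.big.in_cong[THEN iffD1, OF _ sum_in_bigo(1)[OF d' pw[of _ 3 d]]]) (auto simp: that)
  \<comment> \<open>The unspecified cubic coefficient of the jet becomes the leading
    constant.\<close>
  show "\<exists>d. (\<lambda>e. g e - d * e ^ 3) \<in> O[nhds 0](\<lambda>e. e ^ (3 + 1))" if "a = 0" "b = 0" "c = 0"
    using d that by auto
qed

section \<open>Expansions of the one-variable weight function and of f at the root\<close>

lemma jet_weight_fun1:
  assumes "weight_fun1 G"
  shows "jet G (G 0) (deriv G 0) (deriv (deriv G) 0 / 2)"
proof -
  obtain U where U: "open U" "0 \<in> U" and C: "\<And>k. C_k_on k U G"
    and bdd: "\<And>k. k \<ge> 2 \<Longrightarrow> bounded ((deriv ^^ k) G ` U)"
    using assms unfolding weight_fun1_def by blast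
  obtain r where r: "r > 0" "ball 0 r \<subseteq> U"
    using U by (meson openE)
  then have in_U: "t \<in> U" if "\<bar>t\<bar> < r" for t
    using that by (auto simp: subset_iff)
  obtain B where B: "\<And>t. t \<in> U \<Longrightarrow> \<bar>(deriv ^^ 4) G t\<bar> \<le> B"
    using bdd[of 4] unfolding bounded_iff by auto
  have der: "((deriv ^^ m) G has_real_derivative (deriv ^^ Suc m) G t) (at t)" if "t \<in> U" for m t
    using C[of "Suc m"] that unfolding C_k_on_def by (auto intro: field_differentiable_derivI)
  show ?thesis
    using jet_taylor[of r "\<lambda>m. (deriv ^^ m) G" B] r(1) der B in_U by (simp add: numeral_2_eq_2)
qed

text \<open>Continuity of the n-th derivative at \<alpha> supplies the local bound \<open>B\<close>;
  the radius is the smaller of the one for this bound and the one for staying inside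
  \<open>D\<close>.\<close>

lemma C_k_on_taylor_setup:
  assumes "C_k_on n D f" "open D" "\<alpha> \<in> D"
  obtains r B where "r > 0" "\<And>t. \<bar>t\<bar> < r \<Longrightarrow> \<alpha> + t \<in> D"
    "\<And>m t. m < n \<Longrightarrow> \<bar>t\<bar> < r \<Longrightarrow>
       ((\<lambda>t. (deriv ^^ m) f (\<alpha> + t)) has_real_derivative (deriv ^^ Suc m) f (\<alpha> + t)) (at t)"
    "\<And>t. \<bar>t\<bar> < r \<Longrightarrow> \<bar>(deriv ^^ n) f (\<alpha> + t)\<bar> \<le> B"
proof -
  obtain r where r: "r > 0" "ball \<alpha> r \<subseteq> D" using assms(2,3) by (meson openE)
  have "isCont ((deriv ^^ n) f) \<alpha>"
    using assms unfolding C_k_on_def by (simp add: continuous_on_eq_continuous_at)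
  then have "\<forall>\<^sub>F x in nhds \<alpha>. \<bar>(deriv ^^ n) f x\<bar> < \<bar>(deriv ^^ n) f \<alpha>\<bar> + 1"
    by (intro order_tendstoD[OF tendsto_rabs]) (auto simp: isCont_def tendsto_nhds_iff)
  then obtain r' where r': "r' > 0" "\<And>x. dist x \<alpha> < r' \<Longrightarrow> \<bar>(deriv ^^ n) f x\<bar> < \<bar>(deriv ^^ n) f \<alpha>\<bar> + 1"
    unfolding eventually_nhds_metric by blast
  have D: "\<alpha> + t \<in> D" if "\<bar>t\<bar> < min r r'" for t
    using that r(2) by (auto simp: subset_iff dist_norm)
  have der: "((\<lambda>t. (deriv ^^ m) f (\<alpha> + t)) has_real_derivative (deriv ^^ Suc m) f (\<alpha> + t)) (at t)"
    if "m < n" "\<bar>t\<bar> < min r r'" for m t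
  proof -
    have "((deriv ^^ m) f has_real_derivative (deriv ^^ Suc m) f (t + \<alpha>)) (at (t + \<alpha>))"
      using assms(1) that D[of t] unfolding C_k_on_def
      by (auto intro: field_differentiable_derivI simp: add.commute)
    then show ?thesis unfolding DERIV_shift by (simp add: add.commute)
  qed
  show thesis
    by (rule that[of "min r r'" "\<bar>(deriv ^^ n) f \<alpha>\<bar> + 1"])
      (use r(1) r' D der in \<open>auto simp: dist_norm intro: less_imp_le\<close>)
qed

text \<open>Dividing f by e and differentiating f each lose one order, so five derivatives of f give
  remainders O(e^4). Both expansions share c2 and c3, with the factors 2 and 3 of termwise
  differentiation.\<close>

lemma jets_at_simple_root:
  assumes "C_k_on 5 D f" "open D" "\<alpha> \<in> D" "f \<alpha> = 0" "deriv f \<alpha> \<noteq> 0"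
  obtains Q c2 c3 where "\<And>e. f (\<alpha> + e) = e * Q e"
    "jet Q (deriv f \<alpha>) (deriv f \<alpha> * c2) (deriv f \<alpha> * c3)"
    "jet (\<lambda>e. deriv f (\<alpha> + e)) (deriv f \<alpha>) (deriv f \<alpha> * (2 * c2)) (deriv f \<alpha> * (3 * c3))"
proof -
  obtain r B where r: "r > 0"
    and der: "\<And>m t. m < 5 \<Longrightarrow> \<bar>t\<bar> < r \<Longrightarrow>
       ((\<lambda>t. (deriv ^^ m) f (\<alpha> + t)) has_real_derivative (deriv ^^ Suc m) f (\<alpha> + t)) (at t)"
    and B: "\<And>t. \<bar>t\<bar> < r \<Longrightarrow> \<bar>(deriv ^^ 5) f (\<alpha> + t)\<bar> \<le> B"
    by (rule C_k_on_taylor_setup[OF assms(1-3)]) auto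
  \<comment> \<open>The value at e = 0 fills the removable singularity, so that the expansion holds
    on a full neighbourhood.\<close>
  define Q where "Q e = (if e = 0 then deriv f \<alpha> else f (\<alpha> + e) / e)" for e
  \<comment> \<open>the normalized coefficients of the error analysis: \<open>c\<^sub>k\<close> is the \<open>k\<close>-th derivative over \<open>k! * f'(\<alpha>)\<close>\<close>
  define c2 where "c2 = (deriv ^^ 2) f \<alpha> / (2 * deriv f \<alpha>)"
  define c3 where "c3 = (deriv ^^ 3) f \<alpha> / (6 * deriv f \<alpha>)"
  have "jet (\<lambda>e. (deriv ^^ Suc 0) f (\<alpha> + e)) ((deriv ^^ Suc 0) f (\<alpha> + 0)) ((deriv ^^ Suc 1) f (\<alpha> + 0))
     ((deriv ^^ Suc 2) f (\<alpha> + 0) / 2)"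
    by (rule jet_taylor[OF r, where B = B and diff = "\<lambda>m t. (deriv ^^ Suc m) f (\<alpha> + t)"])
      (use der B in \<open>auto simp del: funpow.simps\<close>)
  then have "jet (\<lambda>e. deriv f (\<alpha> + e)) (deriv f \<alpha>) ((deriv ^^ 2) f \<alpha>) ((deriv ^^ 3) f \<alpha> / 2)"
    by (simp add: numeral_2_eq_2 numeral_3_eq_3)
  then have F: "jet (\<lambda>e. deriv f (\<alpha> + e)) (deriv f \<alpha>) (deriv f \<alpha> * (2 * c2)) (deriv f \<alpha> * (3 * c3))"
    by (rule jet_eq_rhs) (use assms(5) in \<open>simp_all add: c2_def c3_def\<close>)
  have "\<forall>\<^sub>F e in nhds (0::real). \<bar>e\<bar> < r"
    by (rule order_tendstoD) (auto intro!: tendsto_eq_intros r)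
  then have "\<forall>\<^sub>F e in nhds 0. norm (Q e - (deriv f \<alpha> + deriv f \<alpha> * c2 * e + deriv f \<alpha> * c3 * e\<^sup>2
     + (deriv ^^ 4) f \<alpha> / 24 * e ^ 3)) \<le> B * norm (e ^ 4)"
  proof eventually_elim
    case (elim e)
    have B0: "0 \<le> B" using B[of 0] r by simp
    let ?P = "deriv f \<alpha> + deriv f \<alpha> * c2 * e + deriv f \<alpha> * c3 * e\<^sup>2 + (deriv ^^ 4) f \<alpha> / 24 * e ^ 3"
    have "\<bar>f (\<alpha> + e) - (\<Sum>m<5. (deriv ^^ m) f (\<alpha> + 0) / fact m * e ^ m)\<bar> \<le> B * \<bar>e\<bar> ^ 5"
      using taylor_bound[of 5 e "\<lambda>m t. (deriv ^^ m) f (\<alpha> + t)" B] der B elim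
      by (simp del: funpow.simps add: funpow_0)
    \<comment> \<open>The constant term is f \<alpha> = 0, so e factors out of the Taylor
      polynomial.\<close>
    also have "(\<Sum>m<5. (deriv ^^ m) f (\<alpha> + 0) / fact m * e ^ m) = e * ?P"
      using assms(4,5) by (simp add: eval_nat_numeral c2_def c3_def algebra_simps)
    finally have *: "\<bar>f (\<alpha> + e) - e * ?P\<bar> \<le> B * \<bar>e\<bar> ^ 5" .
    show ?case
    proof (cases "e = 0")
      case False
      have "\<bar>e\<bar> * \<bar>Q e - ?P\<bar> = \<bar>f (\<alpha> + e) - e * ?P\<bar>"
        using False by (simp add: Q_def right_diff_distrib flip: abs_mult)
      also have "\<dots> \<le> \<bar>e\<bar> * (B * \<bar>e\<bar> ^ 4)"
        using * by (simp add: eval_nat_numeral mult_ac)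
      finally show ?thesis using False by (simp add: power_abs)
    qed (simp add: Q_def)
  qed
  then have J: "jet Q (deriv f \<alpha>) (deriv f \<alpha> * c2) (deriv f \<alpha> * c3)"
    by (intro jetI bigoI)
  show thesis
    by (rule that[OF _ J F]) (use assms(4) in \<open>simp add: Q_def\<close>)
qed

section \<open>Factorization of the error of one step\<close>

lemma scheme_error_factorization:
  assumes "open D" "C_k_on 5 D f" "\<alpha> \<in> D" "f \<alpha> = 0" "deriv f \<alpha> \<noteq> 0"
    and "weight_fun1 G" "weight_fun3 H"
    and "G 0 = 1" "deriv G 0 = 2" "H 0 = 1" "partial_deriv 1 H 0 = 2"
  obtains Y T W c2 b3 r w where
    "\<forall>\<^sub>F e in nhds 0. y_step f (\<alpha> + e) = \<alpha> + e * Y e"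
    "\<forall>\<^sub>F e in nhds 0. z_step f G (\<alpha> + e) = \<alpha> + e * Y e * T e"
    "\<forall>\<^sub>F e in nhds 0. x_step f G H (\<alpha> + e) = \<alpha> + e * Y e * T e * W e"
    "jet Y 0 c2 b3" "jet T 0 0 r" "jet W 0 0 w"
    "partial_deriv 1 (partial_deriv 1 H) 0 = deriv (deriv G) 0 + 2 \<Longrightarrow> partial_deriv 3 H 0 = 1 \<Longrightarrow> w = 0"
proof -
  obtain Q c2 c3 where fQ: "\<And>e. f (\<alpha> + e) = e * Q e"
    and Q: "jet Q (deriv f \<alpha>) (deriv f \<alpha> * c2) (deriv f \<alpha> * c3)"
    and F: "jet (\<lambda>e. deriv f (\<alpha> + e)) (deriv f \<alpha>) (deriv f \<alpha> * (2 * c2)) (deriv f \<alpha> * (3 * c3))"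
    by (rule jets_at_simple_root[OF assms(2,1,3-5)]) blast
  note [simp] = assms(5)
  define Y where "Y e = 1 - Q e / deriv f (\<alpha> + e)" for e
  \<comment> \<open>\<open>t1\<close> and \<open>t3\<close> are the quotients of the scheme with the vanishing factors cancelled; \<open>t3\<close> differs
    from its original at \<open>y = \<alpha>\<close>, where the step returns \<open>\<alpha>\<close> whatever the value of \<open>H\<close>.\<close>
  define t1 where "t1 e = Q (e * Y e) / Q e * Y e" for e
  define T where "T e = 1 - G (t1 e) * (Q (e * Y e) / deriv f (\<alpha> + e))" for e
  define t3 where "t3 e = Q (e * Y e * T e) * T e / Q (e * Y e)" for e
  define W where "W e = 1 - H (vector [t1 e, t1 e * t3 e, t3 e]) * (Q (e * Y e * T e) / deriv f (\<alpha> + e))" for e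
  define g where "g = deriv (deriv G) 0"
  define r where "r = 5 * c2\<^sup>2 - c3 - g / 2 * c2\<^sup>2"
  have Y: "jet Y 0 c2 (2 * c3 - 2 * c2\<^sup>2)"
    unfolding Y_def
    by (rule jet_eq_rhs[OF jet_diff[OF jet_const jet_divide[OF Q F]]])
      (simp_all add: field_simps power2_eq_square)
  have y: "jet (\<lambda>e. e * Y e) 0 0 c2"
    by (rule jet_eq_rhs[OF jet_mult[OF jet_id Y]]) simp_all
  have Qy: "jet (\<lambda>e. Q (e * Y e)) (deriv f \<alpha>) 0 (deriv f \<alpha> * c2\<^sup>2)"
    by (rule jet_eq_rhs[OF jet_compose[OF Q y]]) (simp_all add: power2_eq_square)
  have t1: "jet t1 0 c2 (2 * c3 - 3 * c2\<^sup>2)"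
    unfolding t1_def
    by (rule jet_eq_rhs[OF jet_mult[OF jet_divide[OF Qy Q] Y]])
      (simp_all add: field_simps power2_eq_square)
  \<comment> \<open>The second factor is 1 - 2 c2 e + O(e^2), while G(0) = 1 and G'(0) = 2 make
    G(t1) = 1 + 2 c2 e + O(e^2): the constant and linear terms of \<open>T\<close> cancel.\<close>
  have T: "jet T 0 0 r"
    unfolding T_def
    by (rule jet_eq_rhs[OF jet_diff[OF jet_const jet_mult[OF
          jet_compose[OF jet_weight_fun1[OF assms(6)] t1] jet_divide[OF Qy F]]]])
      (simp_all add: assms r_def g_def field_simps power2_eq_square)
  have z: "jet (\<lambda>e. e * Y e * T e) 0 0 0"
    by (rule jet_eq_rhs[OF jet_mult[OF y T]]) simp_all
  have Qz: "jet (\<lambda>e. Q (e * Y e * T e)) (deriv f \<alpha>) 0 0"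
    by (rule jet_eq_rhs[OF jet_compose[OF Q z]]) simp_all
  have t3: "jet t3 0 0 r"
    unfolding t3_def
    by (rule jet_eq_rhs[OF jet_divide[OF jet_mult[OF Qz T] Qy]]) simp_all
  \<comment> \<open>The second argument of H is O(e^3), so it does not enter the coefficient of e^2
    in \<open>W\<close>.\<close>
  have t2: "jet (\<lambda>e. t1 e * t3 e) 0 0 0"
    by (rule jet_eq_rhs[OF jet_mult[OF t1 t3]]) simp_all
  define w where "w = 6 * c2\<^sup>2 - c3 - partial_deriv 3 H 0 * r
     - partial_deriv 1 (partial_deriv 1 H) 0 / 2 * c2\<^sup>2"
  \<comment> \<open>The same cancellation as for \<open>T\<close>, now from H = 1 and a first
    partial derivative of 2 at the origin.\<close>
  have W: "jet W 0 0 w"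
    unfolding W_def
    by (rule jet_eq_rhs[OF jet_diff[OF jet_const jet_mult[OF
          jet_weight_fun3[OF assms(7) t1 t2 t3] jet_divide[OF Qz F]]]])
      (simp_all add: assms w_def field_simps power2_eq_square)
  have ystep: "y_step f (\<alpha> + e) = \<alpha> + e * Y e" for e
    by (simp add: y_step_def fQ Y_def algebra_simps)
  have Qne: "\<forall>\<^sub>F e in nhds 0. Q e \<noteq> 0"
    by (rule tendsto_imp_eventually_ne[OF jet_tendsto[OF Q]]) simp
  have Qyne: "\<forall>\<^sub>F e in nhds 0. Q (e * Y e) \<noteq> 0"
    by (rule tendsto_imp_eventually_ne[OF jet_tendsto[OF Qy]]) simp
  have Fne: "\<forall>\<^sub>F e in nhds 0. deriv f (\<alpha> + e) \<noteq> 0"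
    by (rule tendsto_imp_eventually_ne[OF jet_tendsto[OF F]]) simp
  \<comment> \<open>This holds for every e: at e = 0 the left side is 0 / 0 = 0 and Y 0 = 0, and
    where Q e = 0 both sides are divisions by zero.\<close>
  have t1_eq: "f (\<alpha> + e * Y e) / f (\<alpha> + e) = t1 e" for e
  proof (cases "e = 0")
    case True
    moreover have "Y 0 = 0"
      by (rule jet_at_0[OF Y])
    ultimately show ?thesis by (simp add: t1_def assms(4))
  qed (simp add: fQ t1_def)
  have zstep: "z_step f G (\<alpha> + e) = \<alpha> + e * Y e * T e" for e
    unfolding z_step_def Let_def ystep t1_eq
    by (simp add: fQ[of "e * Y e"] T_def algebra_simps)
  have xstep: "\<forall>\<^sub>F e in nhds 0. x_step f G H (\<alpha> + e) = \<alpha> + e * Y e * T e * W e"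
    using Qne Qyne Fne
  proof eventually_elim
    case (elim e)
    have fz: "f (\<alpha> + e * Y e * T e) = e * Y e * T e * Q (e * Y e * T e)"
      by (rule fQ)
    show ?case
    proof (cases "e * Y e = 0")
      case True
      then show ?thesis
        unfolding x_step_def Let_def ystep zstep t1_eq fz by auto
    next
      \<comment> \<open>Here \<open>T e\<close> may still vanish; then f(z) = 0 and
        \<open>t3 e\<close> = 0, in agreement with the quotients of the scheme.\<close>
      case False
      then have e: "e \<noteq> 0" "Y e \<noteq> 0" by auto
      have "f (\<alpha> + e * Y e * T e) / f (\<alpha> + e) = t1 e * t3 e"
        unfolding fz fQ t1_def t3_def using e elim by (simp add: field_simps)
      moreover have "f (\<alpha> + e * Y e * T e) / f (\<alpha> + e * Y e) = t3 e"
        unfolding fz fQ t3_def using e elim by (simp add: field_simps)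
      ultimately have "x_step f G H (\<alpha> + e) = \<alpha> + e * Y e * T e
         - H (vector [t1 e, t1 e * t3 e, t3 e]) * (f (\<alpha> + e * Y e * T e) / deriv f (\<alpha> + e))"
        unfolding x_step_def Let_def ystep zstep t1_eq by (simp only:)
      then show ?thesis
        unfolding fz W_def by (simp add: algebra_simps)
    qed
  qed
  show thesis
  proof (rule that[OF _ _ xstep Y T W])
    \<comment> \<open>With a third partial derivative of 1, c3 cancels between \<open>w\<close> and
      \<open>r\<close>, leaving c2^2 (1 + G''(0) / 2 - H11 / 2), where H11 is the second partial
      derivative of H in t1; this is 0 for H11 = G''(0) + 2.\<close>
    show "w = 0" if "partial_deriv 1 (partial_deriv 1 H) 0 = deriv (deriv G) 0 + 2" "partial_deriv 3 H 0 = 1"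
      unfolding w_def r_def g_def that by (simp add: field_simps)
  qed (simp_all add: ystep zstep)
qed

section \<open>Convergence order and local convergence\<close>

text \<open>Substituting e = x - \<alpha> carries a bound on a full neighbourhood of 0 to every
  filter \<open>at \<alpha> within S\<close>, in particular to the points with nonzero
  denominators.\<close>

lemma scheme_order_at_leastI:
  assumes "(\<lambda>e. (x_step f G H (\<alpha> + e) - \<alpha>) - K * e ^ p) \<in> O[nhds 0](\<lambda>e. e ^ (p + 1))"
  shows "scheme_order_at_least p D f G H \<alpha>"
proof -
  have "((\<lambda>x. x - \<alpha>) \<longlongrightarrow> \<alpha> - \<alpha>) (at \<alpha> within {x \<in> D. denominators_nonzero f x})"
    by (intro tendsto_intros)
  then have "((\<lambda>x. x - \<alpha>) \<longlongrightarrow> 0) (at \<alpha> within {x \<in> D. denominators_nonzero f x})"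
    by simp
  from landau_o.big.compose[OF assms this] show ?thesis
    unfolding scheme_order_at_least_def by auto
qed

theorem theorem1:
  fixes D :: "real set" and f G :: "real \<Rightarrow> real" and H :: "real^3 \<Rightarrow> real" and \<alpha> :: real
  assumes "open D" and "is_interval D"
    and "C_k_on 5 D f"
    and "\<alpha> \<in> D" and "f \<alpha> = 0" and "deriv f \<alpha> \<noteq> 0"
    and "weight_fun1 G" and "weight_fun3 H"
    and "G 0 = 1" and "deriv G 0 = 2"
    and "H 0 = 1" and "partial_deriv 1 H 0 = 2"
  shows "scheme_converges D f G H \<alpha> \<and> scheme_order_at_least 6 D f G H \<alpha> \<and>
    (partial_deriv 1 (partial_deriv 1 H) 0 = deriv (deriv G) 0 + 2 \<and> partial_deriv 3 H 0 = 1 \<longrightarrow>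
       scheme_order_at_least 7 D f G H \<alpha>)"
proof (intro conjI impI)
  obtain Y T W c2 b3 r w where
    y: "\<forall>\<^sub>F e in nhds 0. y_step f (\<alpha> + e) = \<alpha> + e * Y e" and
    z: "\<forall>\<^sub>F e in nhds 0. z_step f G (\<alpha> + e) = \<alpha> + e * Y e * T e" and
    x: "\<forall>\<^sub>F e in nhds 0. x_step f G H (\<alpha> + e) = \<alpha> + e * Y e * T e * W e" and
    J: "jet Y 0 c2 b3" "jet T 0 0 r" "jet W 0 0 w" and
    w: "partial_deriv 1 (partial_deriv 1 H) 0 = deriv (deriv G) 0 + 2 \<Longrightarrow> partial_deriv 3 H 0 = 1 \<Longrightarrow> w = 0"
    by (rule scheme_error_factorization[OF assms(1,3-)]) blast
  have "(\<lambda>e::real. e - 1 * e ^ 1) \<in> O[nhds 0](\<lambda>e. e ^ (1 + 1))" by simp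
  \<comment> \<open>Exponents add up: 1 from e, 1 from \<open>Y\<close> and 2 from \<open>T\<close>
    give order 4 for z, with constant c2 r.\<close>
  from leading_mult[OF leading_mult[OF this leading_of_jet(1)[OF J(1)]] leading_of_jet(2)[OF J(2)]]
  have z_lead: "(\<lambda>e. e * Y e * T e - (c2 * r) * e ^ 4) \<in> O[nhds 0](\<lambda>e. e ^ (4 + 1))"
    by (simp add: eval_nat_numeral)
  have order: "scheme_order_at_least (4 + n) D f G H \<alpha>"
    if "(\<lambda>e. W e - L * e ^ n) \<in> O[nhds 0](\<lambda>e. e ^ (n + 1))" for L n
  proof (rule scheme_order_at_leastI, rule landau_o.big.in_cong[THEN iffD1])
    show "(\<lambda>e. e * Y e * T e * W e - c2 * r * L * e ^ (4 + n)) \<in> O[nhds 0](\<lambda>e. e ^ (4 + n + 1))"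
      by (rule leading_mult[OF z_lead that])
    show "\<forall>\<^sub>F e in nhds 0. e * Y e * T e * W e - c2 * r * L * e ^ (4 + n) =
       x_step f G H (\<alpha> + e) - \<alpha> - c2 * r * L * e ^ (4 + n)"
      using x by eventually_elim simp
  qed
  \<comment> \<open>\<open>W\<close> contributes exponent 2 here, and exponent 3 once w = 0.\<close>
  show "scheme_order_at_least 6 D f G H \<alpha>"
    using order[OF leading_of_jet(2)[OF J(3)]] by simp
  show "scheme_order_at_least 7 D f G H \<alpha>"
    if "partial_deriv 1 (partial_deriv 1 H) 0 = deriv (deriv G) 0 + 2 \<and> partial_deriv 3 H 0 = 1"
    using leading_of_jet(3)[OF J(3)] w that order[of _ 3] by auto
  have lim: "((\<lambda>e. \<alpha> + e * Y e) \<longlongrightarrow> \<alpha>) (nhds 0)" "((\<lambda>e. \<alpha> + e * Y e * T e) \<longlongrightarrow> \<alpha>) (nhds 0)"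
    "((\<lambda>e. \<bar>Y e * T e * W e\<bar>) \<longlongrightarrow> 0) (nhds 0)"
    using J[THEN jet_tendsto] by (auto intro!: tendsto_eq_intros)
  \<comment> \<open>The step multiplies e by Y T W, which tends to 0; any bound below 1 would make
    it a contraction.\<close>
  have contract: "\<forall>\<^sub>F e in nhds 0. \<bar>Y e * T e * W e\<bar> < 1 / 2"
    by (rule order_tendstoD(2)[OF lim(3)]) simp
  have "\<forall>\<^sub>F e in nhds 0. \<alpha> + e \<in> D"
    by (rule topological_tendstoD[OF _ assms(1,4)]) (auto intro!: tendsto_eq_intros)
  with y z x topological_tendstoD[OF lim(1) assms(1,4)] topological_tendstoD[OF lim(2) assms(1,4)] contract
  have "\<forall>\<^sub>F e in nhds 0. \<alpha> + e \<in> D \<and> y_step f (\<alpha> + e) \<in> D \<and> z_step f G (\<alpha> + e) \<in> D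
     \<and> \<bar>x_step f G H (\<alpha> + e) - \<alpha>\<bar> \<le> \<bar>e\<bar> / 2"
  proof eventually_elim
    case (elim e)
    have "\<bar>e\<bar> * \<bar>Y e * T e * W e\<bar> \<le> \<bar>e\<bar> * (1 / 2)"
      by (rule mult_left_mono) (use elim in simp_all)
    with elim show ?case by (simp add: abs_mult mult_ac)
  qed
  then obtain \<delta> where \<delta>: "\<delta> > 0" and step: "\<And>e. \<bar>e\<bar> < \<delta> \<Longrightarrow> \<alpha> + e \<in> D \<and> y_step f (\<alpha> + e) \<in> D
     \<and> z_step f G (\<alpha> + e) \<in> D \<and> \<bar>x_step f G H (\<alpha> + e) - \<alpha>\<bar> \<le> \<bar>e\<bar> / 2"
    unfolding eventually_nhds_metric dist_norm real_norm_def diff_0_right by blast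
  show "scheme_converges D f G H \<alpha>"
    unfolding scheme_converges_def
  proof (intro exI[of _ \<delta>] conjI allI impI \<delta>)
    fix u :: "nat \<Rightarrow> real" and n
    assume u0: "\<bar>u 0 - \<alpha>\<bar> < \<delta>" and u: "\<forall>n. u (Suc n) = x_step f G H (u n)"
    have u_step: "u n \<in> D \<and> y_step f (u n) \<in> D \<and> z_step f G (u n) \<in> D
       \<and> \<bar>u (Suc n) - \<alpha>\<bar> \<le> \<bar>u n - \<alpha>\<bar> / 2" if "\<bar>u n - \<alpha>\<bar> < \<delta>" for n
      using step[OF that] u by simp
    \<comment> \<open>The bound by \<delta> is carried along in the induction so that the one-step
      estimate applies again.\<close>
    have bound: "\<bar>u n - \<alpha>\<bar> \<le> \<bar>u 0 - \<alpha>\<bar> * (1 / 2) ^ n \<and> \<bar>u n - \<alpha>\<bar> < \<delta>" for n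
    proof (induction n)
      case (Suc n)
      then have "\<bar>u (Suc n) - \<alpha>\<bar> \<le> \<bar>u n - \<alpha>\<bar> / 2" using u_step by blast
      with Suc abs_ge_zero[of "u n - \<alpha>"] show ?case by (elim conjE, intro conjI) (simp, linarith)
    qed (use u0 in simp)
    show "u n \<in> D" "y_step f (u n) \<in> D" "z_step f G (u n) \<in> D"
      using u_step bound by blast+
    have "((\<lambda>n. \<bar>u 0 - \<alpha>\<bar> * (1 / 2) ^ n) \<longlongrightarrow> \<bar>u 0 - \<alpha>\<bar> * 0) sequentially"
      by (intro tendsto_intros LIMSEQ_power_zero) simp
    then have "(\<lambda>n. u n - \<alpha>) \<longlonglongrightarrow> 0"
      using bound by (intro Lim_null_comparison[of "\<lambda>n. u n - \<alpha>"]) auto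
    then show "u \<longlonglongrightarrow> \<alpha>" by (rule LIM_zero_cancel)
  qed
qed

end
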